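(* Let $\kappa$ be an infinite regular cardinal and let $X=K_{2^\kappa,\kappa}$. Then $\mathsf{SList}(X,\kappa)$ holds but $\mathsf{RList}(X,\kappa)$ fails.
   Context: A graph is $X=(V_X,E_X)$ with $E_X\subseteq [V_X]^2$. A function $c$ with domain $V_X$ is good if $c(v)\neq c(w)$ whenever $\{v,w\}\in E_X$. $\mathsf{RList}(X,\kappa)$ means: for every $L:V_X\to[\kappa]^\kappa$ there is a good $c$ with $c(v)\in L(v)$ for all $v$. For regular $\kappa$, $\mathsf{stat}_\kappa$ is the set of stationary subsets of $\kappa$, and $\mathsf{SList}(X,\kappa)$ means: for every $L:V_X\to\mathsf{stat}_\kappa$ there is a good $c$ with $c(v)\in L(v)$ for all $v$. $K_{\kappa,\lambda}$ is the complete bipartite graph with parts $A,B$ of sizes $\kappa,\lambda$ and edges $\{\{a,b\}:a\in A,b\in B\}$. *)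

theory Defs
  imports Main "HOL-Library.FuncSet"
begin

unbundle cardinal_syntax

text \<open>
  A cardinal is represented, as in the cardinal library of HOL, by a cardinal well-order
  \<open>\<kappa>\<close> with \<open>Card_order \<kappa>\<close>. Its field plays the role of the set of ordinals below
  \<open>\<kappa>\<close>, and membership in \<open>\<kappa>\<close> is the non-strict order on them.
\<close>

type_synonym 'v graph = "'v set \<times> 'v set set"

definition is_graph :: "'v graph \<Rightarrow> bool" where
  "is_graph X \<longleftrightarrow> snd X \<subseteq> {e. e \<subseteq> fst X \<and> card e = 2}"

definition good :: "'v graph \<Rightarrow> ('v \<Rightarrow> 'c) \<Rightarrow> bool" where
  "good X c \<longleftrightarrow> (\<forall>v\<in>fst X. \<forall>w\<in>fst X. {v, w} \<in> snd X \<longrightarrow> c v \<noteq> c w)"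

definition full_size_subsets :: "'k rel \<Rightarrow> 'k set set" where
  "full_size_subsets \<kappa> = {S. S \<subseteq> Field \<kappa> \<and> |S| =o \<kappa>}"

text \<open>
  In the closure condition, \<open>\<delta>\<close> is nonzero and the elements of \<open>C\<close> strictly below \<open>\<delta>\<close>
  are unbounded in \<open>\<delta>\<close>; the strict inequalities force \<open>\<delta>\<close> to be a limit. For the
  cardinal \<open>\<omega>\<close> the condition is vacuous, so there every unbounded set is club.
\<close>

definition club :: "'k rel \<Rightarrow> 'k set \<Rightarrow> bool" where
  "club \<kappa> C \<longleftrightarrow> C \<subseteq> Field \<kappa> \<and> cofinal C \<kappa> \<and>
     (\<forall>\<delta>\<in>Field \<kappa>. underS \<kappa> \<delta> \<noteq> {} \<and>
        (\<forall>\<alpha>\<in>underS \<kappa> \<delta>. \<exists>\<beta>\<in>C \<inter> underS \<kappa> \<delta>. \<alpha> \<in> underS \<kappa> \<beta>) \<longrightarrow> \<delta> \<in> C)"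

definition stat :: "'k rel \<Rightarrow> 'k set set" where
  "stat \<kappa> = {S. S \<subseteq> Field \<kappa> \<and> (\<forall>C. club \<kappa> C \<longrightarrow> S \<inter> C \<noteq> {})}"

definition RList :: "'v graph \<Rightarrow> 'k rel \<Rightarrow> bool" where
  "RList X \<kappa> \<longleftrightarrow>
     (\<forall>L \<in> fst X \<rightarrow> full_size_subsets \<kappa>. \<exists>c. good X c \<and> (\<forall>v\<in>fst X. c v \<in> L v))"

definition SList :: "'v graph \<Rightarrow> 'k rel \<Rightarrow> bool" where
  "SList X \<kappa> \<longleftrightarrow>
     (\<forall>L \<in> fst X \<rightarrow> stat \<kappa>. \<exists>c. good X c \<and> (\<forall>v\<in>fst X. c v \<in> L v))"

text \<open>
  \<open>complete_bipartite \<mu> \<nu> X\<close> says that \<open>X\<close> is a copy of $K_{\mu,\nu}$, on any vertex set.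
\<close>

definition complete_bipartite :: "'p rel \<Rightarrow> 'q rel \<Rightarrow> 'v graph \<Rightarrow> bool" where
  "complete_bipartite \<mu> \<nu> X \<longleftrightarrow>
     (\<exists>A B. A \<inter> B = {} \<and> |A| =o \<mu> \<and> |B| =o \<nu> \<and>
        X = (A \<union> B, {{a, b} |a b. a \<in> A \<and> b \<in> B}))"

lemma complete_bipartite_is_graph:
  assumes "complete_bipartite \<mu> \<nu> X"
  shows "is_graph X"
proof -
  obtain A B where AB: "A \<inter> B = {}" "X = (A \<union> B, {{a, b} |a b. a \<in> A \<and> b \<in> B})"
    using assms unfolding complete_bipartite_def by blast
  have "card {a, b} = 2" if "a \<in> A" "b \<in> B" for a b
  proof -
    have "a \<noteq> b"
      using that AB(1) by blast
    then show ?thesis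
      by simp
  qed
  then show ?thesis
    unfolding is_graph_def AB(2) by auto
qed

lemma complete_bipartite_exists:
  fixes \<mu> :: "'p rel" and \<nu> :: "'q rel"
  assumes "Card_order \<mu>" and "Card_order \<nu>"
  shows "\<exists>X :: ('p + 'q) graph. complete_bipartite \<mu> \<nu> X"
proof -
  let ?A = "Inl ` Field \<mu> :: ('p + 'q) set" and ?B = "Inr ` Field \<nu> :: ('p + 'q) set"
  have "bij_betw Inl (Field \<mu>) ?A" "bij_betw Inr (Field \<nu>) ?B"
    by (simp_all add: bij_betw_def)
  then have "|?A| =o |Field \<mu>|" "|?B| =o |Field \<nu>|"
    by (meson card_of_ordIsoI ordIso_symmetric)+
  then have "|?A| =o \<mu>" "|?B| =o \<nu>"
    using card_of_Field_ordIso[OF assms(1)] card_of_Field_ordIso[OF assms(2)]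
    by (meson ordIso_transitive)+
  moreover have "?A \<inter> ?B = {}"
    by auto
  ultimately have "complete_bipartite \<mu> \<nu> (?A \<union> ?B, {{a, b} |a b. a \<in> ?A \<and> b \<in> ?B})"
    unfolding complete_bipartite_def by (intro exI[of _ ?A] exI[of _ ?B] conjI refl)
  then show ?thesis
    by (rule exI)
qed

end

theory Submission
  imports Defs
begin

text \<open>
  For \<open>SList\<close>, enumerate the side \<open>B\<close> of size \<open>\<kappa>\<close> as \<open>b\<^sub>i\<close> and choose recursively
  \<open>p\<^sub>i < q\<^sub>i\<close> with \<open>q\<^sub>i \<in> L b\<^sub>i\<close> and \<open>q\<^sub>j < p\<^sub>i\<close> for all \<open>j < i\<close>, which regularity permits.
  The complement of the union of the intervals \<open>(p\<^sub>i, q\<^sub>i]\<close> is closed, and it contains every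
  \<open>p\<^sub>i\<close>, so it is a club. Hence \<open>b\<^sub>i\<close> can be coloured by \<open>q\<^sub>i\<close> and each vertex of the other side
  by an element of its list in this club.

  For \<open>RList\<close>, let the lists of \<open>B\<close> be \<open>\<kappa>\<close> disjoint sets of size \<open>\<kappa>\<close>. There are
  \<open>\<kappa>\<^sup>\<kappa> = 2\<^sup>\<kappa>\<close> transversals; using all of them as lists on the other side
  blocks every colouring of \<open>B\<close>.
\<close>

section \<open>Strict order, bounds and unboundedness in a cardinal\<close>

lemma underS_transitive:
  assumes "Well_order r" "x \<in> underS r y" "y \<in> underS r z"
  shows "x \<in> underS r z"
proof -
  have "trans r" "antisym r"
    using assms(1) by (auto simp: order_on_defs)
  then show ?thesis
    using assms(2,3) unfolding underS_def trans_def antisym_def by blast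
qed

lemma underS_asym:
  assumes "Well_order r" "x \<in> underS r y"
  shows "y \<notin> underS r x"
  using underS_transitive[OF assms] unfolding underS_def by blast

lemma underS_linear:
  assumes "Well_order r" "x \<in> Field r" "y \<in> Field r"
  shows "x \<in> underS r y \<or> x = y \<or> y \<in> underS r x"
proof -
  have "total_on (Field r) r"
    using assms(1) by (auto simp: order_on_defs)
  then show ?thesis
    using assms(2,3) unfolding underS_def total_on_def by blast
qed

lemma Card_order_strict_upper_bound:
  assumes "Card_order \<kappa>" "cinfinite \<kappa>" "a \<in> Field \<kappa>"
  shows "\<exists>b\<in>Field \<kappa>. a \<in> underS \<kappa> b"
  using infinite_Card_order_limit[OF assms(1) _ assms(3)] assms(2)
  unfolding cinfinite_def underS_def by blast

text \<open>By regularity \<open>K\<close> is not cofinal. Since \<open>cofinal\<close> is strict,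
  this gives only a non-strict bound \<open>a\<close> of \<open>K\<close>; any \<open>b\<close>
  strictly above \<open>a\<close> makes it strict.\<close>

lemma regularCard_strict_upper_bound:
  assumes \<kappa>: "Card_order \<kappa>" "cinfinite \<kappa>" "regularCard \<kappa>"
    and K: "K \<subseteq> Field \<kappa>" "|K| <o \<kappa>"
  shows "\<exists>b\<in>Field \<kappa>. \<forall>k\<in>K. k \<in> underS \<kappa> b"
proof -
  have wo: "Well_order \<kappa>"
    using \<kappa>(1) by (rule card_order_on_well_order_on)
  have "\<not> cofinal K \<kappa>"
    using \<kappa>(3) K not_ordLess_ordIso unfolding regularCard_def by blast
  then obtain a where a: "a \<in> Field \<kappa>" "\<And>k. k \<in> K \<Longrightarrow> a \<notin> underS \<kappa> k"
    unfolding cofinal_def underS_def by blast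
  obtain b where b: "b \<in> Field \<kappa>" "a \<in> underS \<kappa> b"
    using Card_order_strict_upper_bound[OF \<kappa>(1,2) a(1)] by blast
  have "k \<in> underS \<kappa> b" if "k \<in> K" for k
    using underS_linear[OF wo _ a(1), of k] that K(1) a(2)[OF that] b(2)
      underS_transitive[OF wo _ b(2), of k] by blast
  then show ?thesis
    using b(1) by blast
qed

text \<open>For closure, the nonempty \<open>underS \<kappa> \<delta>\<close> supplies some
  \<open>\<beta>\<close> of the set below \<open>\<delta>\<close>, and then \<open>p\<close> <
  \<open>\<beta>\<close> < \<open>\<delta>\<close>. Meeting these clubs is what makes a stationary
  set unbounded.\<close>

lemma club_above:
  assumes \<kappa>: "Card_order \<kappa>" "cinfinite \<kappa>" and p: "p \<in> Field \<kappa>"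
  shows "club \<kappa> {x. p \<in> underS \<kappa> x}"
proof -
  have wo: "Well_order \<kappa>"
    using \<kappa>(1) by (rule card_order_on_well_order_on)
  have "\<exists>b. p \<in> underS \<kappa> b \<and> a \<in> underS \<kappa> b" if "a \<in> Field \<kappa>" for a
    using underS_linear[OF wo p that] Card_order_strict_upper_bound[OF \<kappa> p]
      Card_order_strict_upper_bound[OF \<kappa> that] underS_transitive[OF wo] by blast
  then have "cofinal {x. p \<in> underS \<kappa> x} \<kappa>"
    unfolding cofinal_def underS_def by blast
  moreover have "{x. p \<in> underS \<kappa> x} \<subseteq> Field \<kappa>"
    unfolding underS_def Field_def by blast
  ultimately show ?thesis
    unfolding club_def using underS_transitive[OF wo] by blast
qed

lemma stat_unbounded:
  assumes "Card_order \<kappa>" "cinfinite \<kappa>" "S \<in> stat \<kappa>" "p \<in> Field \<kappa>"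
  shows "\<exists>q\<in>S. p \<in> underS \<kappa> q"
  using assms(3) club_above[OF assms(1,2,4)] unfolding stat_def by blast

section \<open>Interleaved points and a club avoiding them\<close>

text \<open>Well-founded recursion along \<open>\<kappa>\<close>: at stage \<open>i\<close> fewer
  than \<open>\<kappa>\<close> values \<open>q j\<close> are taken, so regularity gives a
  \<open>p i\<close> above them all, and the unbounded set \<open>S i\<close> has an element above
  \<open>p i\<close>.\<close>

lemma interleaved_choice:
  assumes \<kappa>: "Card_order \<kappa>" "cinfinite \<kappa>" "regularCard \<kappa>"
    and S: "\<And>i. i \<in> Field \<kappa> \<Longrightarrow> S i \<in> stat \<kappa>"
  obtains p q where
    "\<And>i. i \<in> Field \<kappa> \<Longrightarrow> q i \<in> S i"
    "\<And>i. i \<in> Field \<kappa> \<Longrightarrow> p i \<in> underS \<kappa> (q i)"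
    "\<And>i j. j \<in> underS \<kappa> i \<Longrightarrow> q j \<in> underS \<kappa> (p i)"
proof -
  \<comment> \<open>\<open>s\<close> is the pair of \<open>p i\<close> and \<open>q i\<close>. The
    guard is there because the choice principle asks for a witness at every element of the type,
    also outside the field.\<close>
  define P where "P f i s \<longleftrightarrow> (i \<in> Field \<kappa> \<longrightarrow> snd s \<in> S i \<and> fst s \<in> underS \<kappa> (snd s) \<and>
      (\<forall>j\<in>underS \<kappa> i. snd (f j) \<in> underS \<kappa> (fst s)))"
    for f :: "'a \<Rightarrow> 'a \<times> 'a" and i s
  have "\<exists>f. \<forall>i. P f i (f i)"
  proof (rule dependent_wf_choice)
    show "wf (\<kappa> - Id)"
      using card_order_on_well_order_on[OF \<kappa>(1)] by (simp add: well_order_on_def)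
  next
    fix f g :: "'a \<Rightarrow> 'a \<times> 'a" and i s
    assume "\<And>j. (j, i) \<in> \<kappa> - Id \<Longrightarrow> f j = g j"
    then have "f j = g j" if "j \<in> underS \<kappa> i" for j
      using that by (auto simp: underS_def)
    then show "P f i s = P g i s"
      unfolding P_def by simp
  next
    fix i and f :: "'a \<Rightarrow> 'a \<times> 'a"
    assume IH: "\<And>j. (j, i) \<in> \<kappa> - Id \<Longrightarrow> P f j (f j)"
    show "\<exists>s. P f i s"
    proof (cases "i \<in> Field \<kappa>")
      case True
      let ?K = "(\<lambda>j. snd (f j)) ` underS \<kappa> i"
      have "snd (f j) \<in> Field \<kappa>" if "j \<in> underS \<kappa> i" for j
        using IH[of j] that unfolding P_def underS_def Field_def by blast
      then have "?K \<subseteq> Field \<kappa>"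
        by blast
      moreover have "|?K| <o \<kappa>"
        using card_of_image card_of_underS[OF \<kappa>(1) True] by (rule ordLeq_ordLess_trans)
      ultimately obtain p where p: "p \<in> Field \<kappa>" "\<forall>k\<in>?K. k \<in> underS \<kappa> p"
        using regularCard_strict_upper_bound[OF \<kappa>] by blast
      obtain q where "q \<in> S i" "p \<in> underS \<kappa> q"
        using stat_unbounded[OF \<kappa>(1,2) S[OF True] p(1)] by blast
      then have "P f i (p, q)"
        using p(2) unfolding P_def by simp
      then show ?thesis ..
    qed (simp add: P_def)
  qed
  then obtain f where f: "\<And>i. P f i (f i)"
    by blast
  show thesis
  proof
    fix i j assume "j \<in> underS \<kappa> i"
    moreover from this have "i \<in> Field \<kappa>"
      unfolding underS_def Field_def by blast
    ultimately show "snd (f j) \<in> underS \<kappa> (fst (f i))"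
      using f[of i] unfolding P_def by blast
  qed (use f in \<open>auto simp: P_def\<close>)
qed

lemma club_avoiding_interleaved:
  assumes \<kappa>: "Card_order \<kappa>" "cinfinite \<kappa>"
    and pq: "\<And>i. i \<in> Field \<kappa> \<Longrightarrow> p i \<in> underS \<kappa> (q i)"
    and qp: "\<And>i j. j \<in> underS \<kappa> i \<Longrightarrow> q j \<in> underS \<kappa> (p i)"
  obtains C where "club \<kappa> C" "\<And>i. i \<in> Field \<kappa> \<Longrightarrow> q i \<notin> C"
proof
  \<comment> \<open>To lie outside every interval from \<open>p i\<close> (excluded) to
    \<open>q i\<close> (included) is to be above \<open>q i\<close> whenever above
    \<open>p i\<close>. The half-open form keeps \<open>p i\<close> in \<open>C\<close> and removes
    \<open>q i\<close>.\<close>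
  define C where
    "C = {x \<in> Field \<kappa>. \<forall>i\<in>Field \<kappa>. p i \<in> underS \<kappa> x \<longrightarrow> q i \<in> underS \<kappa> x}"
  have wo: "Well_order \<kappa>"
    using \<kappa>(1) by (rule card_order_on_well_order_on)
  note tr = underS_transitive[OF wo]
  have p_mono: "p j \<in> underS \<kappa> (p i)" if "j \<in> underS \<kappa> i" for i j
  proof -
    have "j \<in> Field \<kappa>"
      using that unfolding underS_def Field_def by blast
    then show ?thesis
      using tr[OF pq qp[OF that]] by blast
  qed
  have p_Field: "p i \<in> Field \<kappa>" if "i \<in> Field \<kappa>" for i
    using pq[OF that] unfolding underS_def Field_def by blast
  have p_C: "p i \<in> C" if i: "i \<in> Field \<kappa>" for i
  proof -
    have "q j \<in> underS \<kappa> (p i)" if j: "j \<in> Field \<kappa>" and "p j \<in> underS \<kappa> (p i)" for j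
    proof -
      consider "j \<in> underS \<kappa> i" | "j = i" | "i \<in> underS \<kappa> j"
        using underS_linear[OF wo j i] by blast
      then show ?thesis
      proof cases
        case 1
        then show ?thesis
          by (rule qp)
      next
        case 2
        then show ?thesis
          using that(2) unfolding underS_def by blast
      next
        case 3
        then show ?thesis
          using that(2) p_mono underS_asym[OF wo] by blast
      qed
    qed
    then show ?thesis
      using p_Field[OF i] unfolding C_def by blast
  qed
  have inj: "inj_on p (Field \<kappa>)"
  proof (rule inj_onI)
    fix i j assume "i \<in> Field \<kappa>" "j \<in> Field \<kappa>" "p i = p j"
    then show "i = j"
      using underS_linear[OF wo, of i j] p_mono[of i j] p_mono[of j i]
      unfolding underS_def by auto
  qed
  \<comment> \<open>If \<open>C\<close> had nothing strictly above \<open>a\<close>, every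
    \<open>p i\<close> would lie below some \<open>b\<close> > \<open>a\<close>, so \<open>p\<close>
    would inject the field into an initial segment of size less than
    \<open>\<kappa>\<close>.\<close>
  have "\<exists>b\<in>C. a \<noteq> b \<and> (a, b) \<in> \<kappa>" if a: "a \<in> Field \<kappa>" for a
  proof (rule ccontr)
    assume neg: "\<not> ?thesis"
    obtain b where b: "b \<in> Field \<kappa>" "a \<in> underS \<kappa> b"
      using Card_order_strict_upper_bound[OF \<kappa> a] by blast
    have "p i \<in> underS \<kappa> b" if i: "i \<in> Field \<kappa>" for i
    proof -
      consider "p i \<in> underS \<kappa> a" | "p i = a" | "a \<in> underS \<kappa> (p i)"
        using underS_linear[OF wo p_Field[OF i] a] by blast
      then show ?thesis
      proof cases
        case 1
        then show ?thesis
          using b(2) by (rule tr)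
      next
        case 2
        then show ?thesis
          using b(2) by simp
      next
        case 3
        then show ?thesis
          using neg p_C[OF i] unfolding underS_def by blast
      qed
    qed
    then have "|Field \<kappa>| \<le>o |underS \<kappa> b|"
      using inj card_of_ordLeq by blast
    then have "|Field \<kappa>| <o \<kappa>"
      using card_of_underS[OF \<kappa>(1) b(1)] by (rule ordLeq_ordLess_trans)
    then show False
      using card_of_Field_ordIso[OF \<kappa>(1)] not_ordLess_ordIso by blast
  qed
  then have "cofinal C \<kappa>"
    unfolding cofinal_def by blast
  moreover have "\<delta> \<in> C" if \<delta>: "\<delta> \<in> Field \<kappa>"
    and lim: "\<forall>\<alpha>\<in>underS \<kappa> \<delta>. \<exists>\<beta>\<in>C \<inter> underS \<kappa> \<delta>. \<alpha> \<in> underS \<kappa> \<beta>" for \<delta>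
  proof -
    \<comment> \<open>A point \<open>\<beta>\<close> of \<open>C\<close> between \<open>p i\<close>
      and \<open>\<delta>\<close> lies above \<open>q i\<close> too, by the definition of
      \<open>C\<close>.\<close>
    have "q i \<in> underS \<kappa> \<delta>" if i: "i \<in> Field \<kappa>" and pi: "p i \<in> underS \<kappa> \<delta>" for i
    proof -
      obtain \<beta> where "\<beta> \<in> C" "\<beta> \<in> underS \<kappa> \<delta>" "p i \<in> underS \<kappa> \<beta>"
        using lim pi by blast
      then show ?thesis
        using i tr unfolding C_def by blast
    qed
    then show ?thesis
      using \<delta> unfolding C_def by blast
  qed
  ultimately show "club \<kappa> C"
    unfolding club_def C_def by blast
  show "q i \<notin> C" if "i \<in> Field \<kappa>" for i
    using pq[OF that] that unfolding C_def underS_def by blast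
qed

section \<open>Colouring from stationary lists\<close>

text \<open>The size \<open>\<mu>\<close> of \<open>A\<close> is arbitrary because one club
  \<open>C\<close> serves all of \<open>A\<close>: each list there meets \<open>C\<close>, and
  \<open>A\<close> has no inner edges.\<close>

lemma SList_complete_bipartite:
  assumes \<kappa>: "Card_order \<kappa>" "cinfinite \<kappa>" "regularCard \<kappa>"
    and X: "complete_bipartite \<mu> \<kappa> X"
  shows "SList X \<kappa>"
  unfolding SList_def
proof
  obtain A B where AB: "A \<inter> B = {}" "|B| =o \<kappa>"
    and X_eq: "X = (A \<union> B, {{a, b} |a b. a \<in> A \<and> b \<in> B})"
    using X unfolding complete_bipartite_def by blast
  fix L assume "L \<in> fst X \<rightarrow> stat \<kappa>"
  then have L: "L v \<in> stat \<kappa>" if "v \<in> A \<union> B" for v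
    using that X_eq by auto
  have "|B| =o |Field \<kappa>|"
    using AB(2) card_of_Field_ordIso[OF \<kappa>(1)] ordIso_symmetric ordIso_transitive by blast
  then obtain h where h: "bij_betw h B (Field \<kappa>)"
    using card_of_ordIso by blast
  let ?g = "inv_into B h"
  have g: "?g i \<in> B" if "i \<in> Field \<kappa>" for i
    using h that by (metis bij_betw_imp_surj_on inv_into_into)
  have gh: "?g (h b) = b" if "b \<in> B" for b
    using h that by (simp add: bij_betw_inv_into_left)
  have hB: "h b \<in> Field \<kappa>" if "b \<in> B" for b
    using h that by (rule bij_betwE[THEN bspec])
  have Lg: "L (?g i) \<in> stat \<kappa>" if "i \<in> Field \<kappa>" for i
    using L g that by blast
  obtain p q where q: "\<And>i. i \<in> Field \<kappa> \<Longrightarrow> q i \<in> L (?g i)"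
    and pq: "\<And>i. i \<in> Field \<kappa> \<Longrightarrow> p i \<in> underS \<kappa> (q i)"
      "\<And>i j. j \<in> underS \<kappa> i \<Longrightarrow> q j \<in> underS \<kappa> (p i)"
    by (rule interleaved_choice[where S = "\<lambda>i. L (?g i)", OF \<kappa> Lg]) (assumption, rule that)
  obtain C where C: "club \<kappa> C" "\<And>i. i \<in> Field \<kappa> \<Longrightarrow> q i \<notin> C"
    by (rule club_avoiding_interleaved[OF \<kappa>(1,2) pq]) (assumption | rule that)+
  have "\<exists>x. x \<in> L a \<inter> C" if "a \<in> A" for a
    using L[of a] that C(1) unfolding stat_def by blast
  then obtain d where d: "\<And>a. a \<in> A \<Longrightarrow> d a \<in> L a \<inter> C"
    by metis
  define c where "c v = (if v \<in> B then q (h v) else d v)" for v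
  have cA: "c a \<in> L a \<inter> C" if "a \<in> A" for a
    using that d AB(1) unfolding c_def by auto
  have cB: "c b \<in> L b - C" if "b \<in> B" for b
    using that q[of "h b"] C(2)[of "h b"] hB gh unfolding c_def by simp
  \<comment> \<open>Membership in \<open>C\<close> separates the colours of the two sides, whichever
    endpoint of the edge is named first.\<close>
  have "c v \<noteq> c w" if "{v, w} = {a, b}" "a \<in> A" "b \<in> B" for v w a b
    using cA[OF that(2)] cB[OF that(3)] that(1) by (auto simp: doubleton_eq_iff)
  then have "good X c"
    unfolding good_def X_eq by auto
  moreover have "\<forall>v\<in>fst X. c v \<in> L v"
    using cA cB X_eq by auto
  ultimately show "\<exists>c. good X c \<and> (\<forall>v\<in>fst X. c v \<in> L v)"
    by blast
qed

section \<open>Lists of full size that admit no good colouring\<close>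

text \<open>Bounds the number of transversals: \<open>\<kappa>\<close> < 2^\<open>\<kappa>\<close>,
  and raising 2^\<open>\<kappa>\<close> to the power \<open>\<kappa>\<close> changes nothing since
  \<open>\<kappa>\<close> times \<open>\<kappa>\<close> is \<open>\<kappa>\<close>.\<close>

lemma cexp_self_ordLeq_ctwo_cexp:
  assumes "Cinfinite \<kappa>"
  shows "\<kappa> ^c \<kappa> \<le>o ctwo ^c \<kappa>"
proof -
  have "\<kappa> ^c \<kappa> \<le>o (ctwo ^c \<kappa>) ^c \<kappa>"
    using assms by (blast intro: cexp_mono1 ordLess_imp_ordLeq ordLess_ctwo_cexp)
  also have "(ctwo ^c \<kappa>) ^c \<kappa> =o ctwo ^c \<kappa>"
    using assms Cinfinite_Cnotzero
    by (blast intro: cexp_cprod_ordLeq Card_order_ctwo ordLeq_refl)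
  finally show ?thesis .
qed

lemma not_RList_complete_bipartite:
  assumes \<kappa>: "Card_order \<kappa>" "cinfinite \<kappa>"
    and X: "complete_bipartite (ctwo ^c \<kappa>) \<kappa> X"
  shows "\<not> RList X \<kappa>"
proof
  let ?F = "Field \<kappa>"
  assume RList: "RList X \<kappa>"
  obtain A B where AB: "A \<inter> B = {}" "|A| =o ctwo ^c \<kappa>" "|B| =o \<kappa>"
    and X_eq: "X = (A \<union> B, {{a, b} |a b. a \<in> A \<and> b \<in> B})"
    using X unfolding complete_bipartite_def by blast
  have F: "|?F| =o \<kappa>"
    using \<kappa>(1) by (rule card_of_Field_ordIso)
  \<comment> \<open>The pairing splits the colours into \<open>\<kappa>\<close> disjoint rows of
    size \<open>\<kappa>\<close>, row \<open>i\<close> consisting of the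
    \<open>e (i, j)\<close>.\<close>
  obtain e where e: "bij_betw e (?F \<times> ?F) ?F"
    using card_of_Times_same_infinite \<kappa>(2) card_of_ordIso unfolding cinfinite_def by blast
  have e_in: "e (i, j) \<in> ?F" if "i \<in> ?F" "j \<in> ?F" for i j
    using bij_betwE[OF e] that by blast
  have e_inj: "i = i' \<and> j = j'"
    if "e (i, j) = e (i', j')" "i \<in> ?F" "j \<in> ?F" "i' \<in> ?F" "j' \<in> ?F" for i j i' j'
    using inj_onD[OF bij_betw_imp_inj_on[OF e] that(1)] that(2-) by simp
  have "|B| =o |?F|"
    using AB(3) F ordIso_symmetric ordIso_transitive by blast
  then obtain h where h: "bij_betw h B ?F"
    using card_of_ordIso by blast
  \<comment> \<open>Functions on the field encode transversals of the rows. A surjection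
    \<open>t\<close> from \<open>A\<close> suffices, since vertices of \<open>A\<close> may share a
    list.\<close>
  have "|Func ?F ?F| \<le>o |A|"
    using cexp_self_ordLeq_ctwo_cexp[of \<kappa>] \<kappa> ordLeq_ordIso_trans[OF _ ordIso_symmetric[OF AB(2)]]
    unfolding cexp_def by blast
  moreover have "Func ?F ?F \<noteq> {}"
    using \<kappa>(2) unfolding cinfinite_def by (metis Func_non_emp finite.emptyI)
  ultimately obtain t where t: "t ` A = Func ?F ?F"
    using card_of_ordLeq2[of "Func ?F ?F" A] by blast
  \<comment> \<open>A vertex \<open>v\<close> of \<open>B\<close> receives row \<open>h v\<close>; a
    vertex of \<open>A\<close> receives the transversal taking entry \<open>t v i\<close> from each
    row \<open>i\<close>.\<close>
  define L where
    "L v = (if v \<in> B then (\<lambda>j. e (h v, j)) ` ?F else (\<lambda>i. e (i, t v i)) ` ?F)" for v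
  have full: "f ` ?F \<in> full_size_subsets \<kappa>" if "inj_on f ?F" "f ` ?F \<subseteq> ?F" for f
  proof -
    have "|f ` ?F| =o |?F|"
      using that(1) by (meson bij_betw_imageI card_of_ordIso ordIso_symmetric)
    then show ?thesis
      using that(2) F ordIso_transitive unfolding full_size_subsets_def by blast
  qed
  have "L v \<in> full_size_subsets \<kappa>" if "v \<in> A \<union> B" for v
  proof (cases "v \<in> B")
    case True
    then have "h v \<in> ?F"
      using h bij_betwE by blast
    then have "inj_on (\<lambda>j. e (h v, j)) ?F" "(\<lambda>j. e (h v, j)) ` ?F \<subseteq> ?F"
      using e_in by (blast intro: inj_onI dest: e_inj)+
    then show ?thesis
      using full True unfolding L_def by simp
  next
    case False
    then have "t v \<in> Func ?F ?F"
      using that t by blast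
    then have "t v i \<in> ?F" if "i \<in> ?F" for i
      using that unfolding Func_def by blast
    then have "inj_on (\<lambda>i. e (i, t v i)) ?F" "(\<lambda>i. e (i, t v i)) ` ?F \<subseteq> ?F"
      using e_in by (blast intro: inj_onI dest: e_inj)+
    then show ?thesis
      using full False unfolding L_def by simp
  qed
  then have "L \<in> fst X \<rightarrow> full_size_subsets \<kappa>"
    using X_eq by auto
  then obtain c where good: "good X c" and "\<forall>v\<in>fst X. c v \<in> L v"
    using RList unfolding RList_def by blast
  then have c: "c v \<in> L v" if "v \<in> A \<union> B" for v
    using that X_eq by simp
  have hB: "h ` B = ?F"
    using h by (rule bij_betw_imp_surj_on)
  have "\<exists>j. j \<in> ?F \<and> c (inv_into B h i) = e (i, j)" if i: "i \<in> ?F" for i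
  proof -
    have "inv_into B h i \<in> B" "h (inv_into B h i) = i"
      using i hB by (simp_all add: inv_into_into f_inv_into_f)
    then show ?thesis
      using c[of "inv_into B h i"] unfolding L_def by auto
  qed
  then obtain f where f: "\<And>i. i \<in> ?F \<Longrightarrow> f i \<in> ?F \<and> c (inv_into B h i) = e (i, f i)"
    by metis
  \<comment> \<open>\<open>f\<close> records the colours that \<open>c\<close> uses on
    \<open>B\<close>. Members of \<open>Func\<close> are \<open>undefined\<close> off their domain,
    so \<open>f\<close> is cut down accordingly.\<close>
  have "(\<lambda>i. if i \<in> ?F then f i else undefined) \<in> Func ?F ?F"
    using f unfolding Func_def by simp
  then obtain a where a: "a \<in> A" "t a = (\<lambda>i. if i \<in> ?F then f i else undefined)"
    using t by (metis (no_types, lifting) imageE)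
  have "a \<notin> B"
    using a(1) AB(1) by blast
  \<comment> \<open>The list of \<open>a\<close> consists of colours already used on
    \<open>B\<close>, so \<open>c a\<close> repeats the colour of a neighbour.\<close>
  then obtain i where i: "i \<in> ?F" "c a = e (i, f i)"
    using c[of a] a unfolding L_def by auto
  let ?b = "inv_into B h i"
  have "c a = c ?b"
    using f[OF i(1)] i(2) by simp
  moreover have "?b \<in> B"
    using i(1) hB by (simp add: inv_into_into)
  then have "c a \<noteq> c ?b"
    using good a(1) unfolding good_def X_eq by auto
  ultimately show False
    by contradiction
qed

theorem theorem2p4:
  fixes \<kappa> :: "'k rel" and X :: "'v graph"
  assumes "Card_order \<kappa>" and "cinfinite \<kappa>" and "regularCard \<kappa>"
    and "complete_bipartite (ctwo ^c \<kappa>) \<kappa> X"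
  shows "SList X \<kappa> \<and> \<not> RList X \<kappa>"
  using SList_complete_bipartite[OF assms] not_RList_complete_bipartite[OF assms(1,2,4)] by blast

end
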